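(* For every $\boldsymbol{\Delta}^0_3$ set $A\subseteq 2^\omega$ there exist an open set $U$ and a closed set $C$ (subsets of $2^\omega$) such that $\Phi(U)=\Phi(C)\equiv_W A$.
   Context: $2^\omega$ is the Cantor space; $N_s=\{x: s\subset x\}$; $\mu$ is the coin-tossing measure with $\mu(N_s)=2^{-\mathrm{lh}(s)}$. For measurable $A$, $\Phi(A)=\{x: \lim_{n}\mu(A\cap N_{x\restriction n})/\mu(N_{x\restriction n})=1\}$. $\boldsymbol{\Delta}^0_3$ denotes the sets that are both $F_{\sigma\delta}$ and $G_{\delta\sigma}$. For $X,Y\subseteq 2^\omega$, $X\le_W Y$ (Wadge reducibility) means $X=f^{-1}(Y)$ for some continuous $f:2^\omega\to2^\omega$, and $X\equiv_W Y$ means $X\le_W Y$ and $Y\le_W X$. *)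

theory Defs
  imports "HOL-Probability.Probability"
begin

text \<open>Cantor space is modelled as the type nat \<Rightarrow> bool with the product topology
  (bool carries the discrete order topology).\<close>

definition cyl :: "bool list \<Rightarrow> (nat \<Rightarrow> bool) set" where
  "cyl s = {x. \<forall>i < length s. x i = s ! i}"

definition coin_measure :: "(nat \<Rightarrow> bool) measure" where
  "coin_measure = (\<Pi>\<^sub>M i\<in>(UNIV::nat set). measure_pmf (bernoulli_pmf (1/2)))"

definition restr :: "(nat \<Rightarrow> bool) \<Rightarrow> nat \<Rightarrow> bool list" where
  "restr x n = map x [0..<n]"

definition Phi :: "(nat \<Rightarrow> bool) set \<Rightarrow> (nat \<Rightarrow> bool) set" where
  "Phi A = {x. (\<lambda>n. measure coin_measure (A \<inter> cyl (restr x n))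
                    / measure coin_measure (cyl (restr x n))) \<longlonglongrightarrow> 1}"

definition Fsigma_delta :: "(nat \<Rightarrow> bool) set \<Rightarrow> bool" where
  "Fsigma_delta A \<longleftrightarrow> (\<exists>F :: nat \<Rightarrow> nat \<Rightarrow> (nat \<Rightarrow> bool) set.
      (\<forall>i j. closed (F i j)) \<and> A = (\<Inter>i. \<Union>j. F i j))"

definition Gdelta_sigma :: "(nat \<Rightarrow> bool) set \<Rightarrow> bool" where
  "Gdelta_sigma A \<longleftrightarrow> (\<exists>G :: nat \<Rightarrow> nat \<Rightarrow> (nat \<Rightarrow> bool) set.
      (\<forall>i j. open (G i j)) \<and> A = (\<Union>i. \<Inter>j. G i j))"

definition Delta03 :: "(nat \<Rightarrow> bool) set \<Rightarrow> bool" where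
  "Delta03 A \<longleftrightarrow> Fsigma_delta A \<and> Gdelta_sigma A"

definition wadge_le :: "(nat \<Rightarrow> bool) set \<Rightarrow> (nat \<Rightarrow> bool) set \<Rightarrow> bool" where
  "wadge_le X Y \<longleftrightarrow> (\<exists>f :: (nat \<Rightarrow> bool) \<Rightarrow> (nat \<Rightarrow> bool).
      continuous_on UNIV f \<and> X = f -` Y)"

definition wadge_eq :: "(nat \<Rightarrow> bool) set \<Rightarrow> (nat \<Rightarrow> bool) set \<Rightarrow> bool" where
  "wadge_eq X Y \<longleftrightarrow> wadge_le X Y \<and> wadge_le Y X"

end

theory Submission
  imports Defs "HOL-Library.Discrete_Functions"
begin

text \<open>
  An \<open>F\<^sub>\<sigma>\<^sub>\<delta>\<close> set \<open>A\<close> carries a rank \<open>m\<close> on finite sequences such that \<open>x \<in> A\<close> iff the rank of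
  \<open>x\<close> restricted to \<open>n\<close> tends to infinity. Embed Cantor space by writing the digits of \<open>x\<close> at the
  square positions and zeros elsewhere; the image \<open>K\<close> is closed and null. A point \<open>y \<notin> K\<close> leaves
  \<open>K\<close> at its first nonzero nonsquare position \<open>a\<close>, having read a finite sequence \<open>t\<close> of digits. Fill the
  fraction \<open>1 - 2\<^sup>-\<^sup>m\<^sup>(\<^sup>t\<^sup>)\<close> of the cylinder entered there by requiring a nonzero bit among the next
  \<open>m(t)\<close> ones, except that everything is filled if \<open>N\<^sub>t \<subseteq> A\<close>, and nothing if \<open>N\<^sub>t\<close> misses \<open>A\<close>.
  This gives an open set \<open>U\<close> with \<open>U \<union> K\<close> closed. As the gaps between squares grow, the
  density of \<open>U\<close> along the image of \<open>x\<close> tends to 1 iff the rank tends to infinity, so \<open>\<Phi>(U)\<close> is the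
  union of \<open>U\<close> and the image of \<open>A\<close>. The two exceptions make \<open>\<Phi>(U)\<close> reducible to \<open>A\<close>: a point that
  leaves \<open>K\<close> after reading \<open>t\<close> is sent to a point of \<open>N\<^sub>t\<close> in \<open>A\<close> or outside \<open>A\<close>, as needed.
\<close>

section \<open>Cylinders, topology and coin measure of Cantor space\<close>

definition agree :: "nat \<Rightarrow> (nat \<Rightarrow> bool) \<Rightarrow> (nat \<Rightarrow> bool) \<Rightarrow> bool" where
  "agree n x y \<longleftrightarrow> (\<forall>i<n. x i = y i)"

lemma agree_mono: "agree n x y \<Longrightarrow> k \<le> n \<Longrightarrow> agree k x y"
  by (simp add: agree_def)

lemma cyl_restr: "cyl (restr x n) = {y. agree n y x}"
  by (auto simp: cyl_def restr_def agree_def)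

lemma length_restr [simp]: "length (restr x n) = n"
  by (simp add: restr_def)

lemma cyl_append: "cyl (restr x n @ s) = {y. agree n y x \<and> (\<forall>i<length s. y (n + i) = s ! i)}"
proof -
  have "y i = s ! (i - n)" if "\<forall>i<length s. y (n + i) = s ! i" "i < n + length s" "\<not> i < n"
    for y :: "nat \<Rightarrow> bool" and i
    using that(1)[rule_format, of "i - n"] that(2,3) by simp
  then show ?thesis
    by (fastforce simp: cyl_def agree_def nth_append restr_def)
qed

lemma open_cyl: "open (cyl s)"
proof -
  have "cyl s = (\<Inter>i<length s. (\<lambda>x. x i) -` {s ! i})"
    by (auto simp: cyl_def)
  moreover have "open {b}" for b :: bool
  proof -
    have "{True} = {False<..}" "{False} = {..<True}" by auto
    then show ?thesis by (cases b) (simp_all only: open_greaterThan open_lessThan)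
  qed
  then have "open ((\<lambda>x::nat \<Rightarrow> bool. x i) -` {b})" for i b
    by (intro open_vimage continuous_on_product_coordinates)
  ultimately show ?thesis by auto
qed

lemma open_cantor_iff:
  fixes S :: "(nat \<Rightarrow> bool) set"
  shows "open S \<longleftrightarrow> (\<forall>x\<in>S. \<exists>n. \<forall>y. agree n y x \<longrightarrow> y \<in> S)" (is "?L \<longleftrightarrow> ?R")
proof
  assume ?L
  show ?R
  proof
    fix x assume "x \<in> S"
    with \<open>?L\<close> obtain X where X: "x \<in> (\<Pi>\<^sub>E i\<in>UNIV. X i)" "finite {i. X i \<noteq> UNIV}" "(\<Pi>\<^sub>E i\<in>UNIV. X i) \<subseteq> S"
      unfolding open_fun_def
      by (force dest!: product_topology_open_contains_basis)
    obtain n where n: "\<forall>i\<in>{i. X i \<noteq> UNIV}. i < n"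
      using X(2) by (meson finite_nat_set_iff_bounded)
    have "y \<in> S" if "agree n y x" for y
    proof -
      have "y i \<in> X i" for i
        using n that X(1) by (cases "X i = UNIV") (auto simp: agree_def PiE_iff)
      then show ?thesis using X(3) by (auto simp: PiE_iff)
    qed
    then show "\<exists>n. \<forall>y. agree n y x \<longrightarrow> y \<in> S" by blast
  qed
next
  assume ?R
  show ?L
  proof (subst open_subopen, rule)
    fix x assume "x \<in> S"
    with \<open>?R\<close> obtain n where "\<forall>y. agree n y x \<longrightarrow> y \<in> S" by blast
    then have "cyl (restr x n) \<subseteq> S" by (auto simp: cyl_restr)
    moreover have "x \<in> cyl (restr x n)" by (simp add: cyl_restr agree_def)
    ultimately show "\<exists>T. open T \<and> x \<in> T \<and> T \<subseteq> S" using open_cyl by blast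
  qed
qed

lemma continuous_cantorI:
  fixes f :: "(nat \<Rightarrow> bool) \<Rightarrow> nat \<Rightarrow> bool"
  assumes "\<And>k x. \<exists>n. \<forall>y. agree n y x \<longrightarrow> f y k = f x k"
  shows "continuous_on UNIV f"
proof (intro continuous_on_coordinatewise_then_product)
  fix k
  have "open ((\<lambda>x. f x k) -` B)" for B
    unfolding open_cantor_iff
  proof
    fix x assume x: "x \<in> (\<lambda>x. f x k) -` B"
    obtain n where n: "\<forall>y. agree n y x \<longrightarrow> f y k = f x k" using assms by blast
    have "y \<in> (\<lambda>x. f x k) -` B" if "agree n y x" for y
      using x n[rule_format, OF that] by simp
    then show "\<exists>n. \<forall>y. agree n y x \<longrightarrow> y \<in> (\<lambda>x. f x k) -` B" by blast
  qed
  then show "continuous_on UNIV (\<lambda>x. f x k)"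
    unfolding continuous_on_open_vimage[OF open_UNIV] Int_UNIV_right by blast
qed

interpretation coin: prob_space coin_measure
  unfolding coin_measure_def by (intro prob_space_PiM measure_pmf.prob_space_axioms)

lemma space_coin [simp]: "space coin_measure = UNIV"
  by (simp add: coin_measure_def space_PiM)

text \<open>In this form cylinders are accessible to \<open>sets_PiM_I\<close> and
  \<open>measure_PiM_emb\<close>.\<close>

lemma cyl_emb:
  "cyl s = prod_emb UNIV (\<lambda>_. measure_pmf (bernoulli_pmf (1/2))) {..<length s} (\<Pi>\<^sub>E i\<in>{..<length s}. {s ! i})"
  by (simp add: cyl_def prod_emb_def restrict_PiE_iff Pi_iff Ball_def set_eq_iff)

lemma sets_cyl [measurable]: "cyl s \<in> sets coin_measure"
  unfolding cyl_emb coin_measure_def by (rule sets_PiM_I) simp_all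

lemma measure_cyl: "measure coin_measure (cyl s) = (1/2) ^ length s"
proof -
  interpret product_prob_space "\<lambda>_::nat. measure_pmf (bernoulli_pmf (1/2))" UNIV
    by unfold_locales
  have "measure (measure_pmf (bernoulli_pmf (1/2))) {b} = 1/2" for b
    by (cases b) (auto simp: measure_pmf_single)
  moreover have "measure coin_measure (cyl s) =
      (\<Prod>i<length s. measure (measure_pmf (bernoulli_pmf (1/2))) {s ! i})"
    unfolding cyl_emb coin_measure_def by (intro measure_PiM_emb) auto
  ultimately show ?thesis by (simp only: prod_constant card_lessThan)
qed

text \<open>Measurability refers to the product sigma-algebra. There are only countably many finite
  sequences, so an open set is a countable union of cylinders.\<close>

lemma sets_open_coin: assumes "open S" shows "S \<in> sets coin_measure"
proof -
  have "S = (\<Union>s\<in>{s. cyl s \<subseteq> S}. cyl s)"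
  proof (intro equalityI subsetI)
    fix x assume "x \<in> S"
    then obtain n where "\<forall>y. agree n y x \<longrightarrow> y \<in> S" using assms open_cantor_iff by blast
    then have "cyl (restr x n) \<subseteq> S" "x \<in> cyl (restr x n)" by (auto simp: cyl_restr agree_def)
    then show "x \<in> (\<Union>s\<in>{s. cyl s \<subseteq> S}. cyl s)" by blast
  qed auto
  also have "\<dots> \<in> sets coin_measure"
    by (intro sets.countable_UN') auto
  finally show ?thesis .
qed

section \<open>Ranks for countable intersections of countable unions of closed sets\<close>

text \<open>For \<open>A = (\<Inter>i. \<Union>j. F i j)\<close>, the least \<open>j\<close> such that \<open>F i j\<close> still meets the current
  neighbourhood of \<open>x\<close> stabilises for every \<open>i\<close> iff \<open>x \<in> A\<close>; the rank \<open>m x n\<close> is the least \<open>i\<close>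
  whose candidate \<open>j\<close> has moved at stage \<open>n\<close>.\<close>

lemma Fsigma_delta_rank:
  assumes "Fsigma_delta A"
  obtains m :: "(nat \<Rightarrow> bool) \<Rightarrow> nat \<Rightarrow> nat"
  where "\<And>n x y. agree n y x \<Longrightarrow> m y n = m x n"
    and "\<And>x M. x \<in> A \<Longrightarrow> \<forall>\<^sub>F n in sequentially. M \<le> m x n"
    and "\<And>x. x \<notin> A \<Longrightarrow> \<exists>M. \<exists>\<^sub>F n in sequentially. m x n \<le> M"
proof -
  obtain F where F: "\<And>i j. closed (F i j)" and A: "A = (\<Inter>i::nat. \<Union>j::nat. F i j)"
    using assms unfolding Fsigma_delta_def by blast
  \<comment> \<open>The disjunct \<open>n \<le> j\<close> makes a least \<open>j\<close> exist and
    fails once \<open>n\<close> exceeds \<open>j\<close>. With it \<open>P\<close> is still antitone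
    in \<open>n\<close>, hence \<open>J\<close> is monotone.\<close>
  define P where "P i x n j \<longleftrightarrow> n \<le> j \<or> (\<exists>z\<in>F i j. agree n z x)" for i x n j
  define J where "J i x n = (LEAST j. P i x n j)" for i x n
  \<comment> \<open>Rank \<open>n\<close> is the default when no candidate with index below
    \<open>n\<close> moves.\<close>
  define m where "m x n = (LEAST i. n \<le> i \<or> J i x n \<noteq> J i x (n - 1))" for x n
  have Jc: "J i y k = J i x k" if "agree n y x" "k \<le> n" for i k n x y
  proof -
    have "agree k z y \<longleftrightarrow> agree k z x" for z using that by (auto simp: agree_def)
    then show ?thesis by (simp add: J_def P_def)
  qed
  have PJ: "P i x n (J i x n)" for i x n
    unfolding J_def by (rule LeastI[of _ n]) (simp add: P_def)
  have J_le: "J i x n \<le> j" if "P i x n j" for i x n j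
    unfolding J_def using that by (rule Least_le)
  have P_anti: "P i x n j" if "P i x n' j" "n \<le> n'" for i x n n' j
    using that by (force simp: P_def agree_def)
  have J_mono: "J i x n \<le> J i x n'" if "n \<le> n'" for i x n n'
    using J_le P_anti PJ that by blast
  show thesis
  proof
    fix n x y assume "agree n y (x :: nat \<Rightarrow> bool)"
    then have "J i y n = J i x n" "J i y (n - 1) = J i x (n - 1)" for i
      using Jc by auto
    then show "m y n = m x n" by (simp add: m_def)
  next
    fix x M assume "x \<in> A"
    have ev: "\<forall>\<^sub>F n in sequentially. J i x n = J i x (n - 1)" for i
    proof -
      obtain j where "x \<in> F i j" using \<open>x \<in> A\<close> A by blast
      \<comment> \<open>The point \<open>x\<close> itself witnesses \<open>P i x n j\<close> at
        every stage, so \<open>J i x\<close> is bounded; being monotone, it remains at its maximum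
        once it is reached.\<close>
      then have "J i x n \<le> j" for n by (intro J_le) (auto simp: P_def agree_def)
      then have fin: "finite (range (J i x))" by (auto intro: finite_subset[of _ "{..j}"])
      obtain N where N: "J i x N = Max (range (J i x))"
        using Max_in[OF fin] by fastforce
      have "J i x n = J i x N" if "n \<ge> N" for n
        using J_mono[OF that, of i x] N Max_ge[OF fin, of "J i x n"] by simp
      then have "J i x n = J i x (n - 1)" if "n \<ge> Suc N" for n
        using that by (metis Suc_le_D Suc_le_mono diff_Suc_1 le_SucI)
      then show ?thesis
        unfolding eventually_sequentially by blast
    qed
    have "\<forall>\<^sub>F n in sequentially. \<forall>i<M. J i x n = J i x (n - 1)"
      using eventually_ball_finite[of "{..<M}" "\<lambda>n i. J i x n = J i x (n - 1)" sequentially] ev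
      unfolding Ball_def lessThan_iff by blast
    moreover have "\<forall>\<^sub>F n in sequentially. M \<le> n" by (rule eventually_ge_at_top)
    ultimately show "\<forall>\<^sub>F n in sequentially. M \<le> m x n"
    proof eventually_elim
      case (elim n)
      have "n \<le> m x n \<or> J (m x n) x n \<noteq> J (m x n) x (n - 1)"
        unfolding m_def by (rule LeastI[of _ n]) simp
      with elim show ?case by (meson le_trans not_le)
    qed
  next
    fix x assume "x \<notin> A"
    then obtain i where i: "\<And>j. x \<notin> F i j" using A by blast
    \<comment> \<open>If \<open>J i x\<close> were bounded by \<open>B\<close>, closedness would
      rule out each \<open>j \<le> B\<close> at some stage \<open>N j\<close>, and at the largest of
      these stages no candidate up to \<open>B\<close> would be left.\<close>
    have unb: "\<exists>n. B < J i x n" for B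
    proof (rule ccontr)
      assume "\<nexists>n. B < J i x n"
      then have "J i x n \<le> B" for n by (meson not_le)
      have "\<exists>n. \<not> P i x n j" for j
      proof -
        have "open (- F i j)" "x \<in> - F i j" using F i by (auto simp: open_Compl)
        then obtain k where k: "\<forall>y. agree k y x \<longrightarrow> y \<in> - F i j" using open_cantor_iff by blast
        have "\<not> P i x (max k (Suc j)) j"
        proof
          assume "P i x (max k (Suc j)) j"
          then obtain z where "z \<in> F i j" "agree (max k (Suc j)) z x" by (auto simp: P_def)
          then show False using k agree_mono[of _ z x k] by auto
        qed
        then show ?thesis ..
      qed
      then obtain N where N: "\<And>j. \<not> P i x (N j) j" by metis
      define n where "n = Max (N ` {..B})"
      have "N (J i x n) \<le> n" unfolding n_def using \<open>J i x (Max (N ` {..B})) \<le> B\<close> by auto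
      then show False using P_anti N PJ by blast
    qed
    \<comment> \<open>If the rank exceeded \<open>i\<close> from stage \<open>k\<close> on,
      \<open>J i x\<close> would never move again.\<close>
    have "\<exists>n\<ge>k. m x n \<le> i" for k
    proof (rule ccontr)
      assume *: "\<not> (\<exists>n\<ge>k. m x n \<le> i)"
      have st: "J i x n = J i x (n - 1)" if "n \<ge> k" for n
      proof (rule ccontr)
        assume "J i x n \<noteq> J i x (n - 1)"
        then have "m x n \<le> i" unfolding m_def by (intro Least_le) auto
        with * that show False by blast
      qed
      have "J i x (k + d) = J i x k" for d
      proof (induction d)
        case (Suc d) then show ?case using st[of "k + Suc d"] by simp
      qed simp
      moreover obtain n where "J i x k < J i x n" using unb by blast
      ultimately show False
        using J_mono[of n k i x] by (metis le_add_diff_inverse linorder_not_less nat_le_linear)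
    qed
    then show "\<exists>M. \<exists>\<^sub>F n in sequentially. m x n \<le> M"
      by (auto simp: frequently_sequentially)
  qed
qed

section \<open>Embedding Cantor space along the squares\<close>

definition is_sq :: "nat \<Rightarrow> bool" where "is_sq k \<longleftrightarrow> (\<exists>n. k = n\<^sup>2)"

definition spread :: "(nat \<Rightarrow> bool) \<Rightarrow> nat \<Rightarrow> bool" where
  "spread x k \<longleftrightarrow> is_sq k \<and> x (floor_sqrt k)"

definition digits :: "(nat \<Rightarrow> bool) \<Rightarrow> nat \<Rightarrow> bool" where
  "digits y n = y (n\<^sup>2)"

definition codes :: "(nat \<Rightarrow> bool) set" where
  "codes = {y. \<forall>k. y k \<longrightarrow> is_sq k}"

definition exits_at :: "(nat \<Rightarrow> bool) \<Rightarrow> nat \<Rightarrow> bool" where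
  "exits_at y a \<longleftrightarrow> y a \<and> \<not> is_sq a \<and> (\<forall>b<a. y b \<longrightarrow> is_sq b)"

lemma digits_spread [simp]: "digits (spread x) = x"
  by (auto simp: digits_def spread_def is_sq_def)

lemma spread_in_codes: "spread x \<in> codes"
  by (simp add: spread_def codes_def)

lemma spread_digits: assumes "y \<in> codes" shows "spread (digits y) = y"
proof
  fix k
  show "spread (digits y) k = y k"
    using assms by (cases "is_sq k") (auto simp: digits_def spread_def codes_def is_sq_def)
qed

lemma exits_unique: "exits_at y a \<Longrightarrow> exits_at y b \<Longrightarrow> a = b"
  by (cases a b rule: linorder_cases) (auto simp: exits_at_def)

lemma exits_at_ex: assumes "y k" "\<not> is_sq k" obtains a where "a \<le> k" "exits_at y a"
proof
  let ?a = "LEAST a. y a \<and> \<not> is_sq a"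
  show "?a \<le> k" using assms by (intro Least_le) auto
  show "exits_at y ?a"
    unfolding exits_at_def using LeastI[of "\<lambda>a. y a \<and> \<not> is_sq a" k] assms not_less_Least by blast
qed

lemma not_codes_iff: "y \<notin> codes \<longleftrightarrow> (\<exists>a. exits_at y a)"
proof
  assume "y \<notin> codes"
  then obtain k where "y k" "\<not> is_sq k" by (auto simp: codes_def)
  then show "\<exists>a. exits_at y a" by (rule exits_at_ex) blast
qed (auto simp: codes_def exits_at_def)

lemma exits_at_cong: "agree n y x \<Longrightarrow> a < n \<Longrightarrow> exits_at y a = exits_at x a"
  by (simp add: agree_def exits_at_def)

lemma agree_digits:
  assumes "agree n y x" "k\<^sup>2 \<le> n" shows "agree k (digits y) (digits x)"
  unfolding agree_def digits_def
proof (intro allI impI)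
  fix i assume "i < k"
  then have "i\<^sup>2 < k\<^sup>2" by (simp add: power_strict_mono)
  then show "y (i\<^sup>2) = x (i\<^sup>2)" using assms by (simp add: agree_def)
qed

text \<open>The root lies strictly between \<open>n\<close> and \<open>n + 2\<close>. So a window of
  this kind reads a single new digit.\<close>

lemma is_sq_between: assumes "is_sq i" "n\<^sup>2 < i" "i < (n + 2)\<^sup>2" shows "i = (n + 1)\<^sup>2"
proof -
  obtain k where k: "i = k\<^sup>2" using assms is_sq_def by auto
  then have "n < k" "k < n + 2" using assms power_less_imp_less_base[of _ 2] by auto
  then show ?thesis using k by (metis Suc_eq_plus1 add_2_eq_Suc' less_antisym not_less_eq)
qed

text \<open>The sum telescopes. It will bound the measure of a union over all possible exit
  positions \<open>a\<close>.\<close>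

lemma sum_half_powers_le: "l \<le> e \<Longrightarrow> (\<Sum>a=l..<e. (1/2::real) ^ Suc a) \<le> (1/2) ^ l"
proof -
  assume "l \<le> e"
  then have "(\<Sum>a=l..<e. (1/2::real) ^ Suc a) = (1/2) ^ l - (1/2) ^ e"
  proof (induction e rule: dec_induct)
    case (step n)
    have "(1/2::real) ^ n = 2 * (1/2) ^ Suc n" by simp
    then show ?case
      using step unfolding sum.atLeastLessThan_Suc[OF step(1)] by linarith
  qed simp
  then show ?thesis by simp
qed

section \<open>The open set built from a rank\<close>

locale ranked =
  fixes A :: "(nat \<Rightarrow> bool) set" and m :: "(nat \<Rightarrow> bool) \<Rightarrow> nat \<Rightarrow> nat"
  assumes m_cong: "\<And>n x y. agree n y x \<Longrightarrow> m y n = m x n"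
    and m_in: "\<And>x M. x \<in> A \<Longrightarrow> \<forall>\<^sub>F n in sequentially. M \<le> m x n"
    and m_notin: "\<And>x. x \<notin> A \<Longrightarrow> \<exists>M. \<exists>\<^sub>F n in sequentially. m x n \<le> M"
begin

definition full :: "(nat \<Rightarrow> bool) \<Rightarrow> nat \<Rightarrow> bool" where
  "full x n \<longleftrightarrow> (\<forall>z. agree n z x \<longrightarrow> z \<in> A)"

definition void :: "(nat \<Rightarrow> bool) \<Rightarrow> nat \<Rightarrow> bool" where
  "void x n \<longleftrightarrow> (\<forall>z. agree n z x \<longrightarrow> z \<notin> A)"

text \<open>Only the first \<open>floor_sqrt a\<close> digits are used, although digit number \<open>floor_sqrt a\<close> has
  already been read at an exit \<open>a\<close>: the density just before a digit is read averages over both of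
  its values, so the filling after it must not depend on it.\<close>

definition good :: "(nat \<Rightarrow> bool) \<Rightarrow> nat \<Rightarrow> bool" where
  "good y a \<longleftrightarrow> (let x = digits y; n = floor_sqrt a in
     full x n \<or> (\<not> void x n \<and> (\<exists>j. a < j \<and> j \<le> a + m x n \<and> y j)))"

definition U :: "(nat \<Rightarrow> bool) set" where
  "U = {y. \<exists>a. exits_at y a \<and> good y a}"

lemma U_iff: "exits_at y a \<Longrightarrow> y \<in> U \<longleftrightarrow> good y a"
  unfolding U_def using exits_unique by blast

lemma full_void_cong:
  assumes "agree n y x" shows "full y n = full x n" "void y n = void x n"
proof -
  have "agree n z y = agree n z x" for z using assms by (auto simp: agree_def)
  then show "full y n = full x n" "void y n = void x n" by (auto simp: full_def void_def)
qed

text \<open>After an exit at \<open>a\<close>, no bit past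
  \<open>a + m (digits y) (floor_sqrt a)\<close> matters, and the digits used sit below position
  \<open>a\<close> because \<open>(floor_sqrt a)\<^sup>2 \<le> a\<close>. This makes both
  \<open>U\<close> and the complement of \<open>U \<union> codes\<close> open.\<close>

lemma exit_local:
  assumes a: "exits_at y a"
  obtains N where "\<And>z. agree N z y \<Longrightarrow> exits_at z a \<and> (z \<in> U \<longleftrightarrow> y \<in> U) \<and> agree (floor_sqrt a) (digits z) (digits y)"
proof
  let ?n = "floor_sqrt a"
  let ?N = "Suc (a + m (digits y) ?n)"
  fix z assume z: "agree ?N z y"
  have ex: "exits_at z a" using z a exits_at_cong[of ?N z y a] by simp
  have ag: "agree ?n (digits z) (digits y)"
    using agree_digits[OF z, of ?n] floor_sqrt_power2_le[of a] by linarith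
  have "z j = y j" if "j \<le> a + m (digits y) ?n" for j
    using z that by (simp add: agree_def)
  then have "good z a = good y a"
    unfolding good_def Let_def full_void_cong[OF ag] m_cong[OF ag] by blast
  with ex ag a show "exits_at z a \<and> (z \<in> U \<longleftrightarrow> y \<in> U) \<and> agree ?n (digits z) (digits y)"
    by (simp add: U_iff)
qed

lemma U_codes: "y \<in> U \<Longrightarrow> y \<notin> codes"
  unfolding not_codes_iff U_def by blast

lemma open_U: "open U"
  unfolding open_cantor_iff
proof
  fix y assume "y \<in> U"
  then obtain a where "exits_at y a" unfolding U_def by blast
  then show "\<exists>n. \<forall>z. agree n z y \<longrightarrow> z \<in> U" using exit_local \<open>y \<in> U\<close> by metis
qed

lemma open_outside: "open (- (U \<union> codes))"
  unfolding open_cantor_iff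
proof
  fix y assume y: "y \<in> - (U \<union> codes)"
  then obtain a where "exits_at y a" using not_codes_iff by blast
  then obtain N where N: "\<And>z. agree N z y \<Longrightarrow> exits_at z a \<and> (z \<in> U \<longleftrightarrow> y \<in> U)"
    using exit_local by metis
  have "z \<in> - (U \<union> codes)" if "agree N z y" for z
    using N[OF that] y not_codes_iff[of z] by blast
  then show "\<exists>n. \<forall>z. agree n z y \<longrightarrow> z \<in> - (U \<union> codes)" by blast
qed

lemma sets_U [measurable]: "U \<in> sets coin_measure"
  by (intro sets_open_coin open_U)

section \<open>Density of \<open>U\<close> along codes\<close>

text \<open>A point missing \<open>U\<close> either looks like a code up to
  \<open>(n + 2)\<^sup>2\<close>, or exits earlier at some \<open>a\<close> and then shows
  \<open>M\<close> zeros, because the cylinder meets \<open>A\<close> and the rank is at least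
  \<open>M\<close>. The only free digit in the window sits at \<open>(n + 1)\<^sup>2\<close> and has
  the value \<open>b\<close>.\<close>

lemma cover_outside:
  assumes x: "x \<in> A" and n0: "\<And>n. n0 \<le> n \<Longrightarrow> M \<le> m x n"
    and n: "n0 \<le> n" "n\<^sup>2 < l" "l \<le> (n + 1)\<^sup>2"
  shows "cyl (restr (spread x) l) - U \<subseteq>
    (\<Union>b. cyl (restr ((spread x)((n + 1)\<^sup>2 := b)) ((n + 2)\<^sup>2)) \<union>
      (\<Union>a\<in>{l..<(n + 2)\<^sup>2}. cyl (restr ((spread x)((n + 1)\<^sup>2 := b)) a @ True # replicate M False)))"
    (is "_ \<subseteq> (\<Union>b. cyl (restr (?z b) ?e) \<union> (\<Union>a\<in>_. cyl (restr (?z b) a @ ?s)))")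
proof
  fix y assume y: "y \<in> cyl (restr (spread x) l) - U"
  then have yl: "agree l y (spread x)" and yU: "y \<notin> U" by (auto simp: cyl_restr)
  define b where "b = y ((n + 1)\<^sup>2)"
  have ag: "agree a y (?z b)" if a: "a \<le> ?e" "\<And>i. i < a \<Longrightarrow> y i \<Longrightarrow> is_sq i" for a
    unfolding agree_def
  proof (intro allI impI)
    fix i assume i: "i < a"
    consider "i = (n + 1)\<^sup>2" | "i \<noteq> (n + 1)\<^sup>2" "i < l" | "i \<noteq> (n + 1)\<^sup>2" "l \<le> i" by linarith
    then show "y i = ?z b i"
    proof cases
      case 1 then show ?thesis by (simp add: b_def)
    next
      case 2 then show ?thesis using yl by (simp add: agree_def)
    next
      case 3
      then have "\<not> is_sq i" using is_sq_between[of i n] n i a by auto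
      then show ?thesis using a(2)[OF i] 3 by (auto simp: spread_def)
    qed
  qed
  show "y \<in> (\<Union>b. cyl (restr (?z b) ?e) \<union> (\<Union>a\<in>{l..<?e}. cyl (restr (?z b) a @ ?s)))"
  proof (cases "\<exists>a<?e. exits_at y a")
    case False
    have "is_sq i" if i: "i < ?e" "y i" for i
    proof (rule ccontr)
      assume "\<not> is_sq i"
      then obtain a where "a \<le> i" "exits_at y a" using exits_at_ex[of y i] i(2) by blast
      with False i(1) show False by auto
    qed
    then have "agree ?e y (?z b)" by (intro ag) auto
    then have "y \<in> cyl (restr (?z b) ?e)" by (simp add: cyl_restr)
    then show ?thesis by blast
  next
    case True
    then obtain a where a: "a < ?e" "exits_at y a" by blast
    have "l \<le> a"
    proof (rule ccontr)
      assume "\<not> l \<le> a"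
      then have "exits_at (spread x) a" using exits_at_cong[OF yl] a by simp
      then show False using spread_in_codes not_codes_iff by blast
    qed
    let ?k = "floor_sqrt a"
    have k: "n \<le> ?k" using \<open>l \<le> a\<close> n by (simp add: le_floor_sqrt_iff)
    have "?k\<^sup>2 < (n + 2)\<^sup>2" using floor_sqrt_power2_le[of a] a by linarith
    then have "?k < n + 2" using power_less_imp_less_base by blast
    then have k': "?k \<le> n + 1" by simp
    \<comment> \<open>\<open>good\<close> reads only digits below \<open>?k \<le> n + 1\<close>, at
      positions up to \<open>n\<^sup>2 < l\<close>. So the free digit does not enter, and the rank
      is that of \<open>x\<close>.\<close>
    have "agree (n + 1) (digits y) x"
      unfolding agree_def
    proof (intro allI impI)
      fix i assume "i < n + 1"
      then have "i\<^sup>2 \<le> n\<^sup>2" by (simp add: power_mono)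
      then have "i\<^sup>2 < l" using n by linarith
      then have "y (i\<^sup>2) = spread x (i\<^sup>2)" using yl by (simp add: agree_def)
      then show "digits y i = x i" by (metis digits_def digits_spread)
    qed
    then have dx: "agree ?k (digits y) x" using k' agree_mono by blast
    have "\<not> void x ?k" using x by (auto simp: void_def agree_def)
    moreover have "M \<le> m x ?k" using n0 n k by simp
    ultimately have z: "\<not> y j" if "a < j" "j \<le> a + M" for j
      using yU U_iff[OF a(2)] that
      unfolding good_def Let_def full_void_cong[OF dx] m_cong[OF dx] by auto
    have "y (a + i) = ?s ! i" if "i < length ?s" for i
      using that a(2) z[of "a + i"] by (cases i) (auto simp: exits_at_def)
    moreover have "agree a y (?z b)" using a by (intro ag) (auto simp: exits_at_def)
    ultimately have "y \<in> cyl (restr (?z b) a @ ?s)" by (auto simp: cyl_append)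
    moreover have "a \<in> {l..<?e}" using \<open>l \<le> a\<close> a by simp
    ultimately show ?thesis by blast
  qed
qed

text \<open>For each of the two values of \<open>b\<close>, not exiting and exiting contribute at
  most \<open>(1/2) ^ M * (1/2) ^ l\<close> each, whence the factor 4. For the first,
  \<open>M \<le> n\<close> ensures that \<open>M\<close> further bits fit before
  \<open>(n + 2)\<^sup>2\<close>.\<close>

lemma measure_outside:
  assumes "x \<in> A" "\<And>n. n0 \<le> n \<Longrightarrow> M \<le> m x n"
    and n: "n0 \<le> n" "M \<le> n" "n\<^sup>2 < l" "l \<le> (n + 1)\<^sup>2"
  shows "measure coin_measure (cyl (restr (spread x) l) - U) \<le> 4 * (1/2) ^ M * (1/2) ^ l"
proof -
  let ?e = "(n + 2)\<^sup>2" and ?z = "\<lambda>b. (spread x)((n + 1)\<^sup>2 := b)"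
  let ?s = "True # replicate M False"
  let ?P = "\<lambda>b. cyl (restr (?z b) ?e)" and ?Q = "\<lambda>b a. cyl (restr (?z b) a @ ?s)"
  have le: "l + M \<le> ?e" using n by (simp add: power2_eq_square)
  have "measure coin_measure (cyl (restr (spread x) l) - U) \<le>
      measure coin_measure (\<Union>b. ?P b \<union> (\<Union>a\<in>{l..<?e}. ?Q b a))"
    using cover_outside[OF assms(1,2) n(1,3,4)] by (intro coin.finite_measure_mono) auto
  also have "\<dots> \<le> (\<Sum>b\<in>UNIV. measure coin_measure (?P b \<union> (\<Union>a\<in>{l..<?e}. ?Q b a)))"
    by (intro coin.finite_measure_subadditive_finite) auto
  also have "\<dots> \<le> (\<Sum>b\<in>(UNIV::bool set). 2 * (1/2) ^ M * (1/2) ^ l)"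
  proof (rule sum_mono)
    fix b
    have "measure coin_measure (\<Union>a\<in>{l..<?e}. ?Q b a) \<le> (\<Sum>a=l..<?e. measure coin_measure (?Q b a))"
      by (intro coin.finite_measure_subadditive_finite) auto
    also have "\<dots> = (1/2) ^ M * (\<Sum>a=l..<?e. (1/2) ^ Suc a)"
      by (simp add: measure_cyl sum_distrib_left power_add mult_ac)
    also have "\<dots> \<le> (1/2) ^ M * (1/2) ^ l"
      using le by (intro mult_left_mono sum_half_powers_le) auto
    finally have "measure coin_measure (\<Union>a\<in>{l..<?e}. ?Q b a) \<le> (1/2) ^ M * (1/2) ^ l" .
    moreover have "measure coin_measure (?P b) \<le> (1/2) ^ (M + l)"
      unfolding measure_cyl using le by (intro power_decreasing) auto
    moreover have "measure coin_measure (?P b \<union> (\<Union>a\<in>{l..<?e}. ?Q b a)) \<le>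
        measure coin_measure (?P b) + measure coin_measure (\<Union>a\<in>{l..<?e}. ?Q b a)"
      by (intro measure_Un_le) auto
    ultimately show "measure coin_measure (?P b \<union> (\<Union>a\<in>{l..<?e}. ?Q b a)) \<le> 2 * (1/2) ^ M * (1/2) ^ l"
      by (simp add: power_add)
  qed
  also have "\<dots> = 4 * (1/2) ^ M * (1/2) ^ l" by (simp add: UNIV_bool)
  finally show ?thesis .
qed

abbreviation density :: "(nat \<Rightarrow> bool) \<Rightarrow> nat \<Rightarrow> real" where
  "density y l \<equiv> measure coin_measure (U \<inter> cyl (restr y l)) / measure coin_measure (cyl (restr y l))"

lemma density_eq:
  "density y l = 1 - measure coin_measure (cyl (restr y l) - U) * 2 ^ l"
proof -
  have "measure coin_measure (cyl (restr y l) - U) =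
      measure coin_measure (cyl (restr y l)) - measure coin_measure (U \<inter> cyl (restr y l))"
    by (subst coin.finite_measure_Diff') (auto simp: Int_commute)
  then show ?thesis by (simp add: measure_cyl power_one_over field_simps)
qed

lemma spread_in_Phi: assumes "x \<in> A" shows "spread x \<in> Phi U"
proof -
  let ?d = "\<lambda>l. measure coin_measure (cyl (restr (spread x) l) - U) * 2 ^ l"
  have "?d \<longlonglongrightarrow> 0"
  proof (rule LIMSEQ_I)
    fix r :: real assume "r > 0"
    then obtain M where M: "(1/2) ^ M < r / 4"
      using real_arch_pow_inv[of "r / 4" "1/2"] by auto
    obtain n0 where n0: "\<And>n. n0 \<le> n \<Longrightarrow> M \<le> m x n"
      using m_in[OF assms] unfolding eventually_sequentially by blast
    have "norm (?d l - 0) < r" if l: "(max n0 M + 1)\<^sup>2 < l" for l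
    proof -
      \<comment> \<open>Taking the root of \<open>l - 1\<close> gives the strict lower and weak
        upper bound on \<open>l\<close> that \<open>measure_outside\<close> requires, even when
        \<open>l\<close> is a square.\<close>
      define n where "n = floor_sqrt (l - 1)"
      have "n \<ge> max n0 M + 1" unfolding n_def using l by (simp add: le_floor_sqrt_iff)
      moreover have "n\<^sup>2 < l" using floor_sqrt_power2_le[of "l - 1"] l unfolding n_def by linarith
      moreover have "l \<le> (n + 1)\<^sup>2" using Suc_floor_sqrt_power2_gt[of "l - 1"] unfolding n_def by simp
      ultimately have "measure coin_measure (cyl (restr (spread x) l) - U) \<le> 4 * (1/2) ^ M * (1/2) ^ l"
        using n0 by (intro measure_outside[OF assms, of n0 M n]) auto
      then have "?d l \<le> 4 * (1/2) ^ M * (1/2) ^ l * 2 ^ l" by (intro mult_right_mono) auto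
      also have "\<dots> = 4 * (1/2) ^ M" by (simp add: power_one_over)
      finally show ?thesis using M by simp
    qed
    then show "\<exists>no. \<forall>l\<ge>no. norm (?d l - 0) < r"
      by (metis Suc_le_lessD)
  qed
  then have "(\<lambda>l. 1 - ?d l) \<longlonglongrightarrow> 1 - 0" by (intro tendsto_intros)
  then show ?thesis unfolding Phi_def density_eq by simp
qed

text \<open>The rank is at most \<open>M\<close> for infinitely many \<open>n\<close>. Each time,
  the points that exit right after position \<open>n\<^sup>2\<close> and then show \<open>M\<close>
  zeros miss \<open>U\<close>, as the cylinder is not contained in \<open>A\<close>; they make up
  the fraction \<open>(1/2) ^ Suc M\<close>.\<close>

lemma spread_notin_Phi: assumes "x \<notin> A" shows "spread x \<notin> Phi U"
proof
  assume "spread x \<in> Phi U"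
  then have lim: "density (spread x) \<longlonglongrightarrow> 1" by (simp add: Phi_def)
  obtain M where M: "\<exists>\<^sub>F n in sequentially. m x n \<le> M" using m_notin[OF assms] by blast
  define \<delta> :: real where "\<delta> = (1/2) ^ Suc M"
  have "\<delta> > 0" by (simp add: \<delta>_def)
  then have "\<forall>\<^sub>F l in sequentially. 1 - \<delta> < density (spread x) l"
    using lim by (intro order_tendstoD) auto
  then obtain l0 where l0: "\<And>l. l0 \<le> l \<Longrightarrow> 1 - \<delta> < density (spread x) l"
    unfolding eventually_sequentially by blast
  obtain n where n: "n \<ge> Suc l0" "m x n \<le> M" using M unfolding frequently_sequentially by blast
  \<comment> \<open>Since \<open>n \<ge> 1\<close>, this position is not a square, and an exit here
    uses exactly the rank \<open>m x n\<close>.\<close>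
  let ?l = "Suc (n\<^sup>2)" and ?s = "True # replicate M False"
  have fs: "floor_sqrt ?l = n"
    using n by (intro floor_sqrt_unique) (auto simp: power2_eq_square)
  have nsq: "\<not> is_sq ?l"
    using fs is_sq_def floor_sqrt_inverse_power2 by (metis n_not_Suc_n)
  have "cyl (restr (spread x) ?l @ ?s) \<subseteq> cyl (restr (spread x) ?l) - U"
  proof
    fix y assume "y \<in> cyl (restr (spread x) ?l @ ?s)"
    then have ag: "agree ?l y (spread x)" and s: "\<And>i. i < Suc M \<Longrightarrow> y (?l + i) = ?s ! i"
      by (auto simp: cyl_append)
    have "y ?l" using s[of 0] by simp
    moreover have "is_sq b" if "b < ?l" "y b" for b
      using ag that by (auto simp: agree_def spread_def)
    ultimately have ex: "exits_at y ?l" using nsq by (auto simp: exits_at_def)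
    have dx: "agree n (digits y) x"
      using agree_digits[OF ag, of n] by simp
    have "\<not> full x n" using assms by (auto simp: full_def agree_def)
    moreover have "\<not> y j" if "?l < j" "j \<le> ?l + m x n" for j
      using s[of "j - ?l"] that n by (auto simp: nth_Cons')
    ultimately have "\<not> good y ?l"
      unfolding good_def Let_def fs full_void_cong[OF dx] m_cong[OF dx] by blast
    then show "y \<in> cyl (restr (spread x) ?l) - U"
      using U_iff[OF ex] ag by (simp add: cyl_restr)
  qed
  then have "measure coin_measure (cyl (restr (spread x) ?l @ ?s)) \<le>
      measure coin_measure (cyl (restr (spread x) ?l) - U)"
    by (intro coin.finite_measure_mono) auto
  then have "(1/2) ^ (?l + Suc M) * 2 ^ ?l \<le>
      measure coin_measure (cyl (restr (spread x) ?l) - U) * 2 ^ ?l"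
    unfolding measure_cyl by (intro mult_right_mono) auto
  moreover have "(1/2) ^ (?l + Suc M) * 2 ^ ?l = \<delta>"
    unfolding \<delta>_def power_add by (simp add: power_one_over)
  moreover have "l0 \<le> ?l" using n by (simp add: power2_eq_square) (meson Suc_leD le_SucI le_square le_trans)
  ultimately show False using l0[of ?l] unfolding density_eq by linarith
qed

section \<open>Density points of \<open>U\<close>\<close>

lemma Phi_interior: assumes "y \<in> U" shows "y \<in> Phi U"
proof -
  obtain n where n: "\<forall>z. agree n z y \<longrightarrow> z \<in> U" using open_U assms open_cantor_iff by blast
  have "cyl (restr y l) - U = {}" if "l \<ge> n" for l
    using n that agree_mono by (auto simp: cyl_restr)
  then have "density y l = 1" if "l \<ge> n" for l
    using that by (simp only: density_eq measure_empty mult_zero_left diff_zero)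
  then have "\<forall>\<^sub>F l in sequentially. density y l = 1"
    unfolding eventually_sequentially by blast
  then show ?thesis unfolding Phi_def by (simp add: tendsto_eventually)
qed

lemma Phi_exterior: assumes "y \<notin> U" "y \<notin> codes" shows "y \<notin> Phi U"
proof
  assume "y \<in> Phi U"
  obtain n where n: "\<forall>z. agree n z y \<longrightarrow> z \<in> - (U \<union> codes)"
    using open_outside assms open_cantor_iff by blast
  have "U \<inter> cyl (restr y l) = {}" if "l \<ge> n" for l
    using n that agree_mono by (fastforce simp: cyl_restr)
  then have "density y l = 0" if "l \<ge> n" for l using that by simp
  then have "\<forall>\<^sub>F l in sequentially. density y l = 0"
    unfolding eventually_sequentially by blast
  then have "density y \<longlonglongrightarrow> 0" by (simp add: tendsto_eventually)
  then show False using \<open>y \<in> Phi U\<close> LIMSEQ_unique by (fastforce simp: Phi_def)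
qed

text \<open>Off \<open>codes\<close> the density is eventually constant, as \<open>U\<close> and the
  complement of \<open>U \<union> codes\<close> are open; on \<open>codes\<close> the rank
  decides.\<close>

lemma Phi_U_iff: "y \<in> Phi U \<longleftrightarrow> y \<in> U \<or> y \<in> codes \<and> digits y \<in> A"
proof (cases "y \<in> codes")
  case True
  then show ?thesis
    using spread_in_Phi[of "digits y"] spread_notin_Phi[of "digits y"] U_codes[of y]
    by (auto simp: spread_digits)
qed (use Phi_interior Phi_exterior in auto)

section \<open>Wadge reductions in both directions\<close>

lemma continuous_spread: "continuous_on UNIV spread"
proof (rule continuous_cantorI)
  fix k x
  show "\<exists>n. \<forall>y. agree n y x \<longrightarrow> spread y k = spread x k"
    by (intro exI[of _ "Suc (floor_sqrt k)"]) (simp add: agree_def spread_def)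
qed

lemma le_Phi: "wadge_le A (Phi U)"
proof -
  have "spread x \<in> Phi U \<longleftrightarrow> x \<in> A" for x
    using spread_in_Phi spread_notin_Phi by blast
  then show ?thesis unfolding wadge_le_def using continuous_spread by blast
qed

text \<open>This extends \<open>digits\<close> beyond \<open>codes\<close>. Keeping the digits that
  count at the exit is what gives continuity at codes.\<close>

definition contract :: "(nat \<Rightarrow> bool) \<Rightarrow> nat \<Rightarrow> bool" where
  "contract y = (if y \<in> codes then digits y else
     (SOME z. agree (floor_sqrt (THE a. exits_at y a)) z (digits y) \<and> (z \<in> A \<longleftrightarrow> y \<in> U)))"

lemma contract_exit:
  assumes "exits_at y a"
  shows "contract y = (SOME z. agree (floor_sqrt a) z (digits y) \<and> (z \<in> A \<longleftrightarrow> y \<in> U))"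
proof -
  have "(THE a. exits_at y a) = a" using assms exits_unique by blast
  then show ?thesis using assms not_codes_iff by (auto simp: contract_def)
qed

text \<open>A suitable point exists: \<open>y \<in> U\<close> excludes \<open>void\<close>, since in
  the case \<open>full\<close> the point \<open>digits y\<close> itself lies in \<open>A\<close>,
  and \<open>y \<notin> U\<close> excludes \<open>full\<close>.\<close>

lemma contract_spec:
  assumes "exits_at y a"
  shows "agree (floor_sqrt a) (contract y) (digits y) \<and> (contract y \<in> A \<longleftrightarrow> y \<in> U)"
proof -
  have "\<exists>z. agree (floor_sqrt a) z (digits y) \<and> (z \<in> A \<longleftrightarrow> y \<in> U)"
  proof (cases "y \<in> U")
    case True
    then have "\<not> void (digits y) (floor_sqrt a)"
      unfolding U_iff[OF assms] by (auto simp: good_def Let_def full_def void_def agree_def)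
    then show ?thesis
      using True by (auto simp: void_def)
  next
    case False
    then have "\<not> full (digits y) (floor_sqrt a)"
      unfolding U_iff[OF assms] by (auto simp: good_def Let_def)
    then show ?thesis
      using False by (auto simp: full_def)
  qed
  then show ?thesis unfolding contract_exit[OF assms] by (rule someI_ex)
qed

text \<open>Near a code, a point can exit only so late that \<open>contract\<close> has to keep
  digit \<open>k\<close>. Near any other point the predicate under \<open>SOME\<close> does not
  change, so neither does the chosen point.\<close>

lemma continuous_contract: "continuous_on UNIV contract"
proof (rule continuous_cantorI)
  fix k y
  show "\<exists>n. \<forall>z. agree n z y \<longrightarrow> contract z k = contract y k"
  proof (cases "y \<in> codes")
    case True
    have "contract z k = contract y k" if z: "agree ((k + 1)\<^sup>2) z y" for z
    proof -
      have dk: "digits z k = digits y k"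
        using agree_digits[OF z order_refl] by (simp add: agree_def)
      have "contract z k = digits z k"
      proof (cases "z \<in> codes")
        case False
        then obtain a where a: "exits_at z a" using not_codes_iff by blast
        have "(k + 1)\<^sup>2 \<le> a"
          using exits_at_cong[OF z, of a] a True not_codes_iff by (meson not_le)
        then have "k < floor_sqrt a" by (simp add: le_floor_sqrt_iff Suc_le_eq[symmetric])
        then show ?thesis using contract_spec[OF a] by (simp add: agree_def)
      qed (simp add: contract_def)
      then show ?thesis using dk True by (simp add: contract_def)
    qed
    then show ?thesis by blast
  next
    case False
    then obtain a where a: "exits_at y a" using not_codes_iff by blast
    obtain N where N: "\<And>z. agree N z y \<Longrightarrow> exits_at z a \<and> (z \<in> U \<longleftrightarrow> y \<in> U) \<and>
        agree (floor_sqrt a) (digits z) (digits y)"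
      using exit_local[OF a] by blast
    have "contract z = contract y" if "agree N z y" for z
    proof -
      have "agree (floor_sqrt a) w (digits z) = agree (floor_sqrt a) w (digits y)" for w
        using N[OF that] by (auto simp: agree_def)
      then show ?thesis using N[OF that] a by (simp add: contract_exit[of _ a])
    qed
    then show ?thesis by metis
  qed
qed

lemma Phi_le: "wadge_le (Phi U) A"
proof -
  have "y \<in> Phi U \<longleftrightarrow> contract y \<in> A" for y
  proof (cases "y \<in> codes")
    case True
    then show ?thesis using U_codes by (auto simp: Phi_U_iff contract_def)
  next
    case False
    then obtain a where "exits_at y a" using not_codes_iff by blast
    then show ?thesis using contract_spec False by (simp add: Phi_U_iff)
  qed
  then show ?thesis unfolding wadge_le_def using continuous_contract by blast
qed

end

section \<open>Codes form a closed null set; conclusion\<close>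

lemma closed_codes: "closed codes"
proof -
  have "open (- codes)"
    unfolding open_cantor_iff
  proof
    fix y assume "y \<in> - codes"
    then obtain k where "y k" "\<not> is_sq k" by (auto simp: codes_def)
    then show "\<exists>n. \<forall>z. agree n z y \<longrightarrow> z \<in> - codes"
      by (intro exI[of _ "Suc k"]) (auto simp: agree_def codes_def)
  qed
  then show ?thesis by (simp add: closed_open)
qed

text \<open>Codes vanish at the nonsquare positions \<open>p i\<close>, and \<open>N\<close> such
  constraints leave measure \<open>(1/2) ^ N\<close>.\<close>

lemma codes_null: "measure coin_measure codes = 0"
proof -
  interpret product_prob_space "\<lambda>_::nat. measure_pmf (bernoulli_pmf (1/2))" UNIV
    by unfold_locales
  \<comment> \<open>The shift to \<open>Suc i\<close> avoids position 1, the only successor of a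
    square that is itself a square.\<close>
  define p where "p i = Suc ((Suc i)\<^sup>2)" for i :: nat
  have nsq: "\<not> is_sq (p i)" for i
  proof
    assume "is_sq (p i)"
    moreover have "(Suc i)\<^sup>2 < p i" "p i < (Suc i + 2)\<^sup>2" "p i \<noteq> (Suc i + 1)\<^sup>2"
      by (auto simp: p_def power2_eq_square)
    ultimately show False using is_sq_between by blast
  qed
  have "inj p" by (auto simp: p_def inj_def)
  have "measure coin_measure codes \<le> (1/2) ^ N" for N
  proof -
    let ?J = "p ` {..<N}"
    let ?E = "prod_emb UNIV (\<lambda>_. measure_pmf (bernoulli_pmf (1/2))) ?J (\<Pi>\<^sub>E i\<in>?J. {False})"
    have "codes \<subseteq> ?E"
      using nsq by (auto simp: codes_def prod_emb_def restrict_PiE_iff Pi_iff intro!: restrict_ext)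
    moreover have "?E \<in> sets coin_measure"
      unfolding coin_measure_def by (rule sets_PiM_I) simp_all
    ultimately have "measure coin_measure codes \<le> measure coin_measure ?E"
      by (intro coin.finite_measure_mono)
    also have "\<dots> = (\<Prod>i\<in>?J. measure (measure_pmf (bernoulli_pmf (1/2))) {False})"
      unfolding coin_measure_def by (intro measure_PiM_emb) auto
    also have "\<dots> = (1/2) ^ N"
      using \<open>inj p\<close> by (simp add: measure_pmf_single card_image inj_on_subset)
    finally show ?thesis .
  qed
  moreover have "(\<lambda>N. (1/2::real) ^ N) \<longlonglongrightarrow> 0" by (intro LIMSEQ_realpow_zero) auto
  ultimately have "measure coin_measure codes \<le> 0"
    using LIMSEQ_le_const by blast
  then show ?thesis by (simp add: measure_le_0_iff)
qed

theorem theorem1p4: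
  fixes A :: "(nat \<Rightarrow> bool) set"
  assumes "Delta03 A"
  shows "\<exists>U C :: (nat \<Rightarrow> bool) set. open U \<and> closed C \<and>
           Phi U = Phi C \<and> wadge_eq (Phi U) A"
proof -
  obtain m where "ranked A m"
    using assms Fsigma_delta_rank[of A] unfolding Delta03_def ranked_def by metis
  then interpret ranked A m .
  have null: "codes \<in> null_sets coin_measure"
    using sets_open_coin[of "- codes"] closed_codes codes_null sets.compl_sets[of "- codes" coin_measure]
    by (auto simp: null_sets_def coin.emeasure_eq_measure Compl_eq_Diff_UNIV[symmetric])
  \<comment> \<open>Adding a null set changes no relative measure, so the closed set
    \<open>U \<union> codes\<close> has the same density points as \<open>U\<close>.\<close>
  have "measure coin_measure ((U \<union> codes) \<inter> S) = measure coin_measure (U \<inter> S)"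
    if [measurable]: "S \<in> sets coin_measure" for S
  proof -
    have "measure coin_measure (U \<inter> S \<union> codes \<inter> S) = measure coin_measure (U \<inter> S)"
      using null by (intro measure_Un_null_set) (auto intro: null_set_Int2)
    then show ?thesis by (simp add: Int_Un_distrib2)
  qed
  then have "Phi U = Phi (U \<union> codes)" by (simp add: Phi_def)
  moreover have "closed (U \<union> codes)" using open_outside by (simp only: closed_def)
  ultimately show ?thesis
    using open_U le_Phi Phi_le unfolding wadge_eq_def by blast
qed

end
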